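(* For finite discrete distributions, an optimal testing algorithm for threshold testing (one maximizing $\mathbb{E}[X_\sigma]$ over all adaptive testing algorithms) can be computed by dynamic programming in time polynomial in $n$ and $m$.
   Context: Threshold testing: $X_1,\dots,X_n$ are drawn once upfront i.i.d.\ from a known distribution $F$ on $\mathbb{R}_{\ge0}$. An algorithm tests each box exactly once, in order $1,\dots,n$, choosing a threshold $t_i\ge0$ (possibly adaptively based on earlier outcomes) and learning only whether $X_i\ge t_i$; after all tests it chooses a box $\sigma$ based on the feedback and receives $X_\sigma$. A finite discrete distribution $F$ is given as a list of $m$ (value, probability) pairs, with support $v_1<\dots<v_m$. *)

theory Defs
  imports "HOL-Probability.Probability"
begin

section \<open>Threshold testing\<close>

text \<open>
  A (deterministic, adaptive) testing algorithm maps the feedback on the boxes tested so far to the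
  next threshold, and the feedback on all \<open>n\<close> boxes to the index of the chosen box.  The list of
  answers is in order of testing; earlier thresholds are determined by it and need not be recorded.
\<close>

record testing_algorithm =
  threshold :: "bool list \<Rightarrow> real"
  choice :: "bool list \<Rightarrow> nat"

definition valid :: "nat \<Rightarrow> testing_algorithm \<Rightarrow> bool" where
  "valid n A \<longleftrightarrow>
     (\<forall>h. length h < n \<longrightarrow> threshold A h \<ge> 0) \<and>
     (\<forall>h. length h = n \<longrightarrow> choice A h \<in> {1..n})"

primrec feedback :: "testing_algorithm \<Rightarrow> (nat \<Rightarrow> real) \<Rightarrow> nat \<Rightarrow> bool list" where
  "feedback A X 0 = []"
| "feedback A X (Suc i) =
     feedback A X i @ [X (Suc i) \<ge> threshold A (feedback A X i)]"

definition reward :: "nat \<Rightarrow> testing_algorithm \<Rightarrow> (nat \<Rightarrow> real) \<Rightarrow> real" where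
  "reward n A X = X (choice A (feedback A X n))"

definition expected_reward :: "nat \<Rightarrow> real pmf \<Rightarrow> testing_algorithm \<Rightarrow> real" where
  "expected_reward n F A = measure_pmf.expectation (Pi_pmf {1..n} 0 (\<lambda>_. F)) (reward n A)"

definition optimal :: "nat \<Rightarrow> real pmf \<Rightarrow> testing_algorithm \<Rightarrow> bool" where
  "optimal n F A \<longleftrightarrow>
     valid n A \<and> (\<forall>B. valid n B \<longrightarrow> expected_reward n F B \<le> expected_reward n F A)"


section \<open>Programs on a real random access machine\<close>

text \<open>
  Running time is counted in the arithmetic model, so that it can be polynomial in \<open>n\<close> and \<open>m\<close>
  alone: exact real arithmetic and comparisons at unit cost, but no rounding of reals to integers
  and no real constants besides 0 and 1.  Memory consists of named arrays of naturals (for counters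
  and addresses) and of reals, all of unbounded length; cell 0 of an array serves as a scalar
  variable.  On naturals there is no multiplication, only addition and truncated subtraction, so
  that the unit-cost convention cannot be abused by repeated squaring.
\<close>

datatype nexp =
    NConst nat
  | NRead string nexp
  | NAdd nexp nexp
  | NSub nexp nexp

datatype rexp =
    RZero
  | ROne
  | RRead string nexp
  | RAdd rexp rexp
  | RSub rexp rexp
  | RMul rexp rexp
  | RDiv rexp rexp

datatype bexp =
    NLess nexp nexp
  | RLess rexp rexp
  | BNot bexp
  | BAnd bexp bexp

datatype com =
    Skip
  | NAssign string nexp nexp
  | RAssign string nexp rexp
  | Seq com com
  | Cond bexp com com
  | While bexp com

record state =
  nats :: "string \<Rightarrow> nat \<Rightarrow> nat"
  reals :: "string \<Rightarrow> nat \<Rightarrow> real"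

primrec nval :: "nexp \<Rightarrow> state \<Rightarrow> nat" where
  "nval (NConst k) s = k"
| "nval (NRead a i) s = nats s a (nval i s)"
| "nval (NAdd i j) s = nval i s + nval j s"
| "nval (NSub i j) s = nval i s - nval j s"

primrec rval :: "rexp \<Rightarrow> state \<Rightarrow> real" where
  "rval RZero s = 0"
| "rval ROne s = 1"
| "rval (RRead a i) s = reals s a (nval i s)"
| "rval (RAdd x y) s = rval x s + rval y s"
| "rval (RSub x y) s = rval x s - rval y s"
| "rval (RMul x y) s = rval x s * rval y s"
| "rval (RDiv x y) s = rval x s / rval y s"

primrec bval :: "bexp \<Rightarrow> state \<Rightarrow> bool" where
  "bval (NLess i j) s \<longleftrightarrow> nval i s < nval j s"
| "bval (RLess x y) s \<longleftrightarrow> rval x s < rval y s"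
| "bval (BNot b) s \<longleftrightarrow> \<not> bval b s"
| "bval (BAnd b c) s \<longleftrightarrow> bval b s \<and> bval c s"

text \<open>Evaluating an expression costs one step per constant, memory access and operation in it.\<close>

primrec ncost :: "nexp \<Rightarrow> nat" where
  "ncost (NConst k) = 1"
| "ncost (NRead a i) = 1 + ncost i"
| "ncost (NAdd i j) = 1 + ncost i + ncost j"
| "ncost (NSub i j) = 1 + ncost i + ncost j"

primrec rcost :: "rexp \<Rightarrow> nat" where
  "rcost RZero = 1"
| "rcost ROne = 1"
| "rcost (RRead a i) = 1 + ncost i"
| "rcost (RAdd x y) = 1 + rcost x + rcost y"
| "rcost (RSub x y) = 1 + rcost x + rcost y"
| "rcost (RMul x y) = 1 + rcost x + rcost y"
| "rcost (RDiv x y) = 1 + rcost x + rcost y"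

primrec bcost :: "bexp \<Rightarrow> nat" where
  "bcost (NLess i j) = 1 + ncost i + ncost j"
| "bcost (RLess x y) = 1 + rcost x + rcost y"
| "bcost (BNot b) = 1 + bcost b"
| "bcost (BAnd b c) = 1 + bcost b + bcost c"

definition nwrite :: "string \<Rightarrow> nat \<Rightarrow> nat \<Rightarrow> state \<Rightarrow> state" where
  "nwrite a k x s = s\<lparr>nats := (nats s)(a := (nats s a)(k := x))\<rparr>"

definition rwrite :: "string \<Rightarrow> nat \<Rightarrow> real \<Rightarrow> state \<Rightarrow> state" where
  "rwrite a k x s = s\<lparr>reals := (reals s)(a := (reals s a)(k := x))\<rparr>"

text \<open>\<open>exec c s t s'\<close>: started in \<open>s\<close>, program \<open>c\<close> halts in \<open>s'\<close> after exactly \<open>t\<close> steps.\<close>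

inductive exec :: "com \<Rightarrow> state \<Rightarrow> nat \<Rightarrow> state \<Rightarrow> bool" where
  Skip: "exec Skip s 1 s"
| NAssign: "exec (NAssign a i e) s (1 + ncost i + ncost e) (nwrite a (nval i s) (nval e s) s)"
| RAssign: "exec (RAssign a i e) s (1 + ncost i + rcost e) (rwrite a (nval i s) (rval e s) s)"
| Seq: "exec c1 s1 t1 s2 \<Longrightarrow> exec c2 s2 t2 s3 \<Longrightarrow> exec (Seq c1 c2) s1 (t1 + t2) s3"
| CondTrue: "bval b s \<Longrightarrow> exec c1 s t s' \<Longrightarrow> exec (Cond b c1 c2) s (1 + bcost b + t) s'"
| CondFalse: "\<not> bval b s \<Longrightarrow> exec c2 s t s' \<Longrightarrow> exec (Cond b c1 c2) s (1 + bcost b + t) s'"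
| WhileFalse: "\<not> bval b s \<Longrightarrow> exec (While b c) s (1 + bcost b) s"
| WhileTrue: "bval b s1 \<Longrightarrow> exec c s1 t1 s2 \<Longrightarrow> exec (While b c) s2 t2 s3 \<Longrightarrow>
    exec (While b c) s1 (1 + bcost b + t1 + t2) s3"

inductive_cases SkipE: "exec Skip s t s'"
inductive_cases NAssignE: "exec (NAssign a i e) s t s'"
inductive_cases RAssignE: "exec (RAssign a i e) s t s'"
inductive_cases SeqE: "exec (Seq c1 c2) s t s'"
inductive_cases CondE: "exec (Cond b c1 c2) s t s'"
inductive_cases WhileE: "exec (While b c) s t s'"

lemma exec_deterministic:
  "exec c s t s' \<Longrightarrow> exec c s u s'' \<Longrightarrow> u = t \<and> s'' = s'"
proof (induction arbitrary: u s'' rule: exec.induct)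
  case (Seq c1 s1 t1 s2 c2 t2 s3)
  from Seq.prems obtain u1 u2 r where u: "u = u1 + u2" "exec c1 s1 u1 r" "exec c2 r u2 s''"
    by (rule SeqE)
  from Seq.IH(1)[OF u(2)] have r: "u1 = t1" "r = s2" by auto
  from Seq.IH(2)[OF u(3)[unfolded r]] show ?case using u(1) r(1) by simp
next
  case (CondTrue b s c1 t s' c2)
  from CondTrue.prems CondTrue.hyps(1) obtain v where v: "u = 1 + bcost b + v" "exec c1 s v s''"
    by (auto elim: CondE)
  from CondTrue.IH[OF v(2)] show ?case using v(1) by simp
next
  case (CondFalse b s c2 t s' c1)
  from CondFalse.prems CondFalse.hyps(1) obtain v where v: "u = 1 + bcost b + v" "exec c2 s v s''"
    by (auto elim: CondE)
  from CondFalse.IH[OF v(2)] show ?case using v(1) by simp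
next
  case (WhileFalse b s c)
  from WhileFalse.prems show ?case
    by (rule WhileE) (use WhileFalse.hyps in auto)
next
  case (WhileTrue b s1 c t1 s2 t2 s3)
  from WhileTrue.prems WhileTrue.hyps(1) obtain u1 u2 r
    where u: "u = 1 + bcost b + u1 + u2" "exec c s1 u1 r" "exec (While b c) r u2 s''"
    by (auto elim: WhileE)
  from WhileTrue.IH(1)[OF u(2)] have r: "u1 = t1" "r = s2" by auto
  from WhileTrue.IH(2)[OF u(3)[unfolded r]] show ?case using u(1) r(1) by simp
qed (auto elim: SkipE NAssignE RAssignE)


section \<open>Input and output\<close>

definition value_prob_pairs :: "real pmf \<Rightarrow> (real \<times> real) list" where
  "value_prob_pairs F = map (\<lambda>v. (v, pmf F v)) (sorted_list_of_set (set_pmf F))"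

definition input :: "nat \<Rightarrow> (real \<times> real) list \<Rightarrow> state" where
  "input n vps =
     \<lparr>nats = (\<lambda>_ _. 0)(''n'' := (\<lambda>_. 0)(0 := n), ''m'' := (\<lambda>_. 0)(0 := length vps)),
      reals = (\<lambda>_ _. 0)
        (''value'' := (\<lambda>j. if j < length vps then fst (vps ! j) else 0),
         ''prob'' := (\<lambda>j. if j < length vps then snd (vps ! j) else 0))\<rparr>"

text \<open>
  A testing algorithm is output as the transition table of a finite automaton reading the feedback:
  at node \<open>q\<close> test the next box with threshold \<open>threshold[q]\<close> and move to node \<open>yes[q]\<close> or \<open>no[q]\<close>
  according to the answer; when all boxes are tested, choose box number \<open>box[q]\<close>.  (Writing out a
  decision tree instead would take exponential time, as there are \<open>2 ^ n\<close> feedback sequences.)  The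
  initial node is \<open>start[0]\<close>.
\<close>

definition node_after :: "state \<Rightarrow> bool list \<Rightarrow> nat" where
  "node_after s h = foldl (\<lambda>q y. nats s (if y then ''yes'' else ''no'') q) (nats s ''start'' 0) h"

definition output_algorithm :: "state \<Rightarrow> testing_algorithm" where
  "output_algorithm s =
     \<lparr>threshold = (\<lambda>h. reals s ''threshold'' (node_after s h)),
      choice = (\<lambda>h. nats s ''box'' (node_after s h))\<rparr>"

end

theory Submission
  imports Defs
begin

text \<open>
  By independence, the conditional means of the boxes given the feedback depend only on the test of
  the box in question, so all that matters about the past is the largest conditional mean \<open>r\<close> of a
  tested box.  With \<open>k\<close> boxes left, the optimal value \<open>V k r\<close> satisfies \<open>V 0 r = r\<close> and
  \<open>V (k + 1) r = (MAX t. \<Sum>y. P (y at t) * V k (max r (E [X | y at t])))\<close>, where the answer \<open>y\<close> ranges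
  over yes and no, and \<open>t\<close> may be restricted to the support of \<open>F\<close>.  Hence \<open>r\<close> takes at most \<open>2 * m\<close>
  values, and together with the index of the box attaining it there are \<open>2 * m * n\<close> states for each
  \<open>k\<close>: these are the nodes of the automaton, filled in by increasing \<open>k\<close> in \<open>O(n\<^sup>2 * m\<^sup>2)\<close> steps.
\<close>

section \<open>The Bellman recursion\<close>

definition hit :: "real pmf \<Rightarrow> real \<Rightarrow> bool \<Rightarrow> real" where
  "hit F t y = measure_pmf.expectation F (\<lambda>x. of_bool ((x \<ge> t) = y))"

definition partial_mean :: "real pmf \<Rightarrow> real \<Rightarrow> bool \<Rightarrow> real" where
  "partial_mean F t y = measure_pmf.expectation F (\<lambda>x. x * of_bool ((x \<ge> t) = y))"

text \<open>For an outcome of probability 0 this is \<open>0 / 0 = 0\<close>.\<close>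

definition cond_mean :: "real pmf \<Rightarrow> real \<Rightarrow> bool \<Rightarrow> real" where
  "cond_mean F t y = partial_mean F t y / hit F t y"

text \<open>Expected value of \<open>g\<close> at the complete feedback, given the feedback
  \<open>h\<close> so far and \<open>k\<close> tests to go; by independence each answer has its
  one-box probability \<open>hit\<close>.\<close>

primrec history_value :: "real pmf \<Rightarrow> testing_algorithm \<Rightarrow> (bool list \<Rightarrow> real) \<Rightarrow> nat \<Rightarrow> bool list \<Rightarrow> real"
  where
  "history_value F A g 0 h = g h"
| "history_value F A g (Suc k) h =
     (\<Sum>y\<in>UNIV. hit F (threshold A h) y * history_value F A g k (h @ [y]))"

primrec bellman :: "real pmf \<Rightarrow> nat \<Rightarrow> real \<Rightarrow> real" where
  "bellman F 0 r = r"
| "bellman F (Suc k) r =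
     Max ((\<lambda>t. \<Sum>y\<in>UNIV. hit F t y * bellman F k (max r (cond_mean F t y))) ` set_pmf F)"

text \<open>The conditional mean of the \<open>b\<close>-th box (counted from 0) given the feedback \<open>h\<close>.\<close>

definition box_mean :: "real pmf \<Rightarrow> testing_algorithm \<Rightarrow> bool list \<Rightarrow> nat \<Rightarrow> real" where
  "box_mean F A h b = cond_mean F (threshold A (take b h)) (h ! b)"

lemma box_mean_append [simp]: "b < length h \<Longrightarrow> box_mean F A (h @ [y]) b = box_mean F A h b"
  by (simp add: box_mean_def nth_append)

lemma box_mean_last [simp]: "box_mean F A (h @ [y]) (length h) = cond_mean F (threshold A h) y"
  by (simp add: box_mean_def)

section \<open>Feedback histories and the expected reward\<close>

lemma hit_nonneg: "hit F t y \<ge> 0"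
  unfolding hit_def by (intro integral_nonneg_AE AE_pmfI) simp

text \<open>Unrolling the recursion gives a sum over all continuations of \<open>h\<close>, the form
  in which the expectation is computed; a continuation splits into its first answer and the
  rest.\<close>

lemma history_value_eq_sum:
  "history_value F A g k h =
     (\<Sum>h'\<in>{h'. length h' = k}. (\<Prod>i<k. hit F (threshold A (h @ take i h')) (h' ! i)) * g (h @ h'))"
proof (induction k arbitrary: h)
  case 0
  have "{h' :: bool list. length h' = 0} = {[]}" by auto
  then show ?case by simp
next
  case (Suc k)
  let ?f = "\<lambda>h'. (\<Prod>i<Suc k. hit F (threshold A (h @ take i h')) (h' ! i)) * g (h @ h')"
  have lists: "{h' :: bool list. length h' = Suc k} = (\<lambda>(y, h'). y # h') ` (UNIV \<times> {h'. length h' = k})"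
    by (auto simp: length_Suc_conv image_iff)
  have "(\<Sum>h'\<in>{h'. length h' = Suc k}. ?f h') =
      (\<Sum>(y, h')\<in>UNIV \<times> {h'. length h' = k}. ?f (y # h'))"
    unfolding lists by (subst sum.reindex) (auto simp: inj_on_def case_prod_unfold)
  also have "\<dots> = (\<Sum>y\<in>UNIV. \<Sum>h'\<in>{h'. length h' = k}. ?f (y # h'))"
    by (subst sum.cartesian_product) simp
  also have "\<dots> = history_value F A g (Suc k) h"
    unfolding history_value.simps Suc.IH sum_distrib_left
    by (intro sum.cong refl) (simp add: prod.lessThan_Suc_shift del: prod.lessThan_Suc)
  finally show ?case by simp
qed

lemma length_feedback [simp]: "length (feedback A X n) = n"
  by (induction n) auto

text \<open>Fixing the feedback fixes all thresholds, so an adaptive run becomes one separate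
  condition per box and independence applies.\<close>

lemma feedback_eq_iff:
  "length h = n \<Longrightarrow>
     feedback A X n = h \<longleftrightarrow> (\<forall>i<n. (X (Suc i) \<ge> threshold A (take i h)) = h ! i)"
proof (induction n arbitrary: h)
  case (Suc n)
  then obtain h' y where h: "h = h' @ [y]" "length h' = n"
    by (metis length_Suc_conv_rev)
  have "feedback A X (Suc n) = h \<longleftrightarrow> feedback A X n = h' \<and> (X (Suc n) \<ge> threshold A h') = y"
    by (auto simp: h)
  also have "\<dots> \<longleftrightarrow> (\<forall>i<n. (X (Suc i) \<ge> threshold A (take i h')) = h' ! i) \<and>
      (X (Suc n) \<ge> threshold A h') = y"
    using Suc.IH h(2) by simp
  also have "\<dots> \<longleftrightarrow> (\<forall>i<Suc n. (X (Suc i) \<ge> threshold A (take i h)) = h ! i)"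
    by (auto simp: h less_Suc_eq nth_append)
  finally show ?case .
qed simp

locale finite_distribution =
  fixes F :: "real pmf"
  assumes finite_support: "finite (set_pmf F)"
    and support_nonneg: "set_pmf F \<subseteq> {0..}"
begin

lemma integrable_F: "integrable (measure_pmf F) (f :: real \<Rightarrow> real)"
  by (rule integrable_measure_pmf_finite[OF finite_support])

lemma expectation_F: "measure_pmf.expectation F f = (\<Sum>x\<in>set_pmf F. pmf F x * f x)"
  for f :: "real \<Rightarrow> real"
  by (subst integral_measure_pmf[OF finite_support]) auto

lemma partial_mean_nonneg: "partial_mean F t y \<ge> 0"
  unfolding partial_mean_def using support_nonneg by (intro integral_nonneg_AE AE_pmfI) auto

lemma cond_mean_nonneg: "cond_mean F t y \<ge> 0"
  by (simp add: cond_mean_def hit_nonneg partial_mean_nonneg)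

text \<open>If an answer has probability 0, no support point produces it and the partial mean
  vanishes too; hence the convention \<open>0 / 0 = 0\<close> is harmless.\<close>

lemma partial_mean_eq: "partial_mean F t y = hit F t y * cond_mean F t y"
proof (cases "hit F t y = 0")
  case True
  then have "(\<Sum>x\<in>set_pmf F. pmf F x * of_bool ((x \<ge> t) = y)) = 0"
    by (simp add: hit_def expectation_F)
  then have "\<forall>x\<in>set_pmf F. pmf F x * of_bool ((x \<ge> t) = y) = 0"
    by (subst (asm) sum_nonneg_eq_0_iff) (auto simp: finite_support)
  then have "\<forall>x\<in>set_pmf F. ((x \<ge> t) = y) = False"
    by (auto simp: set_pmf_iff)
  then have "partial_mean F t y = 0"
    by (simp add: partial_mean_def expectation_F)
  then show ?thesis using True by simp
qed (simp add: cond_mean_def)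

text \<open>On a fixed history the integrand is a product of functions of single boxes: an indicator
  for each box, times the value for the chosen one.\<close>

lemma expectation_reward_on_history:
  assumes "length h = n" and c: "c \<in> {1..n}"
  shows "measure_pmf.expectation (Pi_pmf {1..n} 0 (\<lambda>_. F)) (\<lambda>X. X c * of_bool (feedback A X n = h)) =
    (\<Prod>i<n. hit F (threshold A (take i h)) (h ! i)) * box_mean F A h (c - 1)"
proof -
  \<comment> \<open>Boxes are numbered from 1 and answers from 0, hence the shifts by 1.\<close>
  define T where "T b x \<longleftrightarrow> (x \<ge> threshold A (take (b - 1) h)) = h ! (b - 1)" for b x
  define f where "f b x = (if b = c then x else 1) * of_bool (T b x)" for b :: nat and x :: real
  define p where "p b = hit F (threshold A (take (b - 1) h)) (h ! (b - 1))" for b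
  have "X c * of_bool (feedback A X n = h) = (\<Prod>b\<in>{1..n}. f b (X b))" for X
  proof -
    have "feedback A X n = h \<longleftrightarrow> (\<forall>b\<in>{1..n}. T b (X b))"
      unfolding feedback_eq_iff[OF assms(1)] T_def image_Suc_lessThan[symmetric] by auto
    moreover have "(\<Prod>b\<in>{1..n}. f b (X b)) = X c * (\<Prod>b\<in>{1..n}. of_bool (T b (X b)))"
      using c by (simp add: f_def prod.distrib prod.delta)
    moreover have "(\<Prod>b\<in>{1..n}. of_bool (T b (X b)) :: real) = of_bool (\<forall>b\<in>{1..n}. T b (X b))"
      by (auto intro: prod.neutral)
    ultimately show ?thesis by simp
  qed
  then have "measure_pmf.expectation (Pi_pmf {1..n} 0 (\<lambda>_. F)) (\<lambda>X. X c * of_bool (feedback A X n = h)) =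
      measure_pmf.expectation (Pi_pmf {1..n} 0 (\<lambda>_. F)) (\<lambda>X. \<Prod>b\<in>{1..n}. f b (X b))"
    by simp
  also have "\<dots> = (\<Prod>b\<in>{1..n}. measure_pmf.expectation F (f b))"
    by (rule expectation_prod_Pi_pmf) (use support_nonneg in \<open>auto simp: f_def intro: integrable_F\<close>)
  also have "\<dots> = (\<Prod>b\<in>{1..n}. p b * (if b = c then box_mean F A h (c - 1) else 1))"
  proof (rule prod.cong)
    fix b assume "b \<in> {1..n}"
    show "measure_pmf.expectation F (f b) = p b * (if b = c then box_mean F A h (c - 1) else 1)"
      using partial_mean_eq[of "threshold A (take (b - 1) h)" "h ! (b - 1)"]
      unfolding f_def T_def p_def box_mean_def by (auto simp: partial_mean_def hit_def)
  qed simp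
  also have "\<dots> = (\<Prod>b\<in>{1..n}. p b) * box_mean F A h (c - 1)"
    using c by (simp add: prod.distrib prod.delta)
  also have "(\<Prod>b\<in>{1..n}. p b) = (\<Prod>i<n. p (Suc i))"
    by (rule prod.reindex_bij_witness[where i = Suc and j = "\<lambda>b. b - 1"]) auto
  finally show ?thesis by (simp add: p_def)
qed

lemma expected_reward_eq_history_value:
  assumes "valid n A"
  shows "expected_reward n F A = history_value F A (\<lambda>h. box_mean F A h (choice A h - 1)) n []"
proof -
  let ?L = "{h :: bool list. length h = n}"
  let ?M = "measure_pmf (Pi_pmf {1..n} 0 (\<lambda>_. F))"
  have fin: "finite ?L" using finite_lists_length_eq[of "UNIV :: bool set" n] by simp
  have int: "integrable ?M (f :: _ \<Rightarrow> real)" for f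
    by (rule integrable_measure_pmf_finite) (simp add: set_Pi_pmf finite_PiE_dflt finite_support)
  \<comment> \<open>Exactly one history matches the realized feedback.\<close>
  have "reward n A X = (\<Sum>h\<in>?L. X (choice A h) * of_bool (feedback A X n = h))" for X
    using fin by (simp add: reward_def of_bool_def if_distrib sum.delta' cong: if_cong)
  then have "reward n A = (\<lambda>X. \<Sum>h\<in>?L. X (choice A h) * of_bool (feedback A X n = h))"
    by (rule ext)
  then have "expected_reward n F A =
      (\<Sum>h\<in>?L. measure_pmf.expectation (Pi_pmf {1..n} 0 (\<lambda>_. F))
        (\<lambda>X. X (choice A h) * of_bool (feedback A X n = h)))"
    unfolding expected_reward_def by (simp only: Bochner_Integration.integral_sum[OF int])
  also have "\<dots> = (\<Sum>h\<in>?L. (\<Prod>i<n. hit F (threshold A (take i h)) (h ! i)) *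
      box_mean F A h (choice A h - 1))"
    using assms by (intro sum.cong expectation_reward_on_history) (auto simp: valid_def)
  finally show ?thesis by (simp add: history_value_eq_sum)
qed

section \<open>The Bellman value as an upper bound\<close>

lemma bellman_candidate_le:
  assumes "s \<in> set_pmf F"
  shows "(\<Sum>y\<in>UNIV. hit F s y * bellman F k (max r (cond_mean F s y))) \<le> bellman F (Suc k) r"
  using assms finite_support by simp

text \<open>Any threshold acts on the support like one of its points, or like the smallest of them with
  the two answers exchanged.\<close>

lemma bellman_any_threshold:
  "(\<Sum>y\<in>UNIV. hit F t y * bellman F k (max r (cond_mean F t y))) \<le> bellman F (Suc k) r"
proof (cases "\<exists>s\<in>set_pmf F. s \<ge> t")
  case True
  \<comment> \<open>Rounding \<open>t\<close> up to the next support point skips no support point,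
    so no answer changes.\<close>
  define s where "s = Min {s \<in> set_pmf F. s \<ge> t}"
  have "s \<in> {s \<in> set_pmf F. s \<ge> t}"
    unfolding s_def using True finite_support by (intro Min_in) auto
  moreover have "s \<le> x" if "x \<in> set_pmf F" "x \<ge> t" for x
    unfolding s_def using that finite_support by (intro Min_le) auto
  ultimately have s: "s \<in> set_pmf F" "\<And>x. x \<in> set_pmf F \<Longrightarrow> (x \<ge> t) = (x \<ge> s)"
    by force+
  have "hit F t y = hit F s y" "partial_mean F t y = partial_mean F s y" for y
    unfolding hit_def partial_mean_def expectation_F by (auto intro!: sum.cong simp: s(2))
  then show ?thesis using bellman_candidate_le[OF s(1)] by (simp add: cond_mean_def)
next
  case False
  \<comment> \<open>A test at \<open>t\<close> is always answered no, a test at the smallest support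
    point always yes.\<close>
  define s where "s = Min (set_pmf F)"
  have s: "s \<in> set_pmf F" "\<And>x. x \<in> set_pmf F \<Longrightarrow> (x \<ge> t) = (\<not> x \<ge> s)"
    unfolding s_def using False finite_support by (auto simp: set_pmf_not_empty)
  have "hit F t y = hit F s (\<not> y)" "partial_mean F t y = partial_mean F s (\<not> y)" for y
    unfolding hit_def partial_mean_def expectation_F by (auto intro!: sum.cong simp: s(2))
  then show ?thesis using bellman_candidate_le[OF s(1)]
    by (simp add: cond_mean_def UNIV_bool add.commute)
qed

text \<open>By induction on the remaining tests: \<open>r\<close> dominates the means of all tested
  boxes, and each test raises it to the maximum with the new mean. In the end all boxes are tested,
  so \<open>r\<close> dominates \<open>g\<close>.\<close>

lemma history_value_le_bellman:
  assumes "\<And>h. length h = n \<Longrightarrow> \<exists>b<n. g h \<le> box_mean F A h b"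
    and "length h + k = n" and "r \<ge> 0" and "\<And>b. b < length h \<Longrightarrow> box_mean F A h b \<le> r"
  shows "history_value F A g k h \<le> bellman F k r"
  using assms(2-)
proof (induction k arbitrary: h r)
  case 0
  then show ?case using assms(1)[of h] by force
next
  case (Suc k)
  have "history_value F A g k (h @ [y]) \<le> bellman F k (max r (cond_mean F (threshold A h) y))" for y
  proof (rule Suc.IH)
    fix b assume "b < length (h @ [y])"
    then consider "b < length h" | "b = length h" by fastforce
    then show "box_mean F A (h @ [y]) b \<le> max r (cond_mean F (threshold A h) y)"
      using Suc.prems(3) by cases (auto intro: max.coboundedI1)
  qed (use Suc.prems in auto)
  then have "history_value F A g (Suc k) h \<le> (\<Sum>y\<in>UNIV. hit F (threshold A h) y *
      bellman F k (max r (cond_mean F (threshold A h) y)))"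
    unfolding history_value.simps by (intro sum_mono mult_left_mono hit_nonneg)
  also have "\<dots> \<le> bellman F (Suc k) r" by (rule bellman_any_threshold)
  finally show ?case .
qed

lemma expected_reward_le_bellman:
  assumes "valid n A"
  shows "expected_reward n F A \<le> bellman F n 0"
  unfolding expected_reward_eq_history_value[OF assms]
proof (rule history_value_le_bellman)
  fix h :: "bool list" assume "length h = n"
  then have "choice A h \<in> {1..n}" using assms by (simp add: valid_def)
  then show "\<exists>b<n. box_mean F A h (choice A h - 1) \<le> box_mean F A h b"
    by (intro exI[of _ "choice A h - 1"]) auto
qed auto

end


section \<open>Time-bounded execution of loops\<close>

lemma nats_nwrite [simp]:
  "nats (nwrite a k x s) b = (if a = b then (nats s a)(k := x) else nats s b)"
  by (simp add: nwrite_def)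

lemma reals_nwrite [simp]: "reals (nwrite a k x s) = reals s"
  by (simp add: nwrite_def)

lemma reals_rwrite [simp]:
  "reals (rwrite a k x s) b = (if a = b then (reals s a)(k := x) else reals s b)"
  by (simp add: rwrite_def)

lemma nats_rwrite [simp]: "nats (rwrite a k x s) = nats s"
  by (simp add: rwrite_def)

section \<open>Evaluation and cost of loop-free programs\<close>

primrec loop_free :: "com \<Rightarrow> bool" where
  "loop_free Skip \<longleftrightarrow> True"
| "loop_free (NAssign a i e) \<longleftrightarrow> True"
| "loop_free (RAssign a i e) \<longleftrightarrow> True"
| "loop_free (Seq c1 c2) \<longleftrightarrow> loop_free c1 \<and> loop_free c2"
| "loop_free (Cond b c1 c2) \<longleftrightarrow> loop_free c1 \<and> loop_free c2"
| "loop_free (While b c) \<longleftrightarrow> False"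

text \<open>Functional evaluation, so that loop-free code can be verified by simplification. The
  clause for \<open>While\<close> is a dummy.\<close>

primrec run :: "com \<Rightarrow> state \<Rightarrow> state" where
  "run Skip s = s"
| "run (NAssign a i e) s = nwrite a (nval i s) (nval e s) s"
| "run (RAssign a i e) s = rwrite a (nval i s) (rval e s) s"
| "run (Seq c1 c2) s = run c2 (run c1 s)"
| "run (Cond b c1 c2) s = (if bval b s then run c1 s else run c2 s)"
| "run (While b c) s = s"

text \<open>For loop-free code an upper bound on the time: both branches of a conditional are
  charged.\<close>

primrec max_cost :: "com \<Rightarrow> nat" where
  "max_cost Skip = 1"
| "max_cost (NAssign a i e) = 1 + ncost i + ncost e"
| "max_cost (RAssign a i e) = 1 + ncost i + rcost e"
| "max_cost (Seq c1 c2) = max_cost c1 + max_cost c2"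
| "max_cost (Cond b c1 c2) = 1 + bcost b + max_cost c1 + max_cost c2"
| "max_cost (While b c) = 0"

lemma exec_loop_free: "loop_free c \<Longrightarrow> \<exists>t\<le>max_cost c. exec c s t (run c s)"
proof (induction c arbitrary: s)
  case (Seq c1 c2)
  then obtain t1 t2 where "t1 \<le> max_cost c1" "exec c1 s t1 (run c1 s)"
    "t2 \<le> max_cost c2" "exec c2 (run c1 s) t2 (run c2 (run c1 s))"
    by fastforce
  then show ?case by (auto intro!: exI[of _ "t1 + t2"] exec.Seq)
next
  case (Cond b c1 c2)
  then obtain t1 t2 where *: "t1 \<le> max_cost c1" "exec c1 s t1 (run c1 s)"
    "t2 \<le> max_cost c2" "exec c2 s t2 (run c2 s)"
    by fastforce
  show ?case
  proof (cases "bval b s")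
    case True
    with * show ?thesis by (intro exI[of _ "1 + bcost b + t1"]) (simp add: exec.CondTrue[simplified])
  next
    case False
    with * show ?thesis by (intro exI[of _ "1 + bcost b + t2"]) (simp add: exec.CondFalse[simplified])
  qed
qed (auto intro: exec.intros[simplified] exec.intros)

text \<open>A Hoare triple for total correctness with a time bound.\<close>

definition runs :: "(state \<Rightarrow> bool) \<Rightarrow> com \<Rightarrow> nat \<Rightarrow> (state \<Rightarrow> bool) \<Rightarrow> bool" where
  "runs P c T Q \<longleftrightarrow> (\<forall>s. P s \<longrightarrow> (\<exists>t s'. exec c s t s' \<and> t \<le> T \<and> Q s'))"

lemma runs_loop_free:
  assumes "loop_free c" "max_cost c \<le> T" "\<And>s. P s \<Longrightarrow> Q (run c s)"
  shows "runs P c T Q"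
  using exec_loop_free[OF assms(1)] assms(2,3) unfolding runs_def by (meson order_trans)

lemma runs_Seq:
  assumes "runs P c1 T1 Q" "runs Q c2 T2 R"
  shows "runs P (Seq c1 c2) (T1 + T2) R"
  using assms unfolding runs_def by (meson exec.Seq add_mono)

lemma runs_weaken:
  assumes "runs P c T Q" "\<And>s. P' s \<Longrightarrow> P s" "T \<le> T'" "\<And>s. Q s \<Longrightarrow> Q' s"
  shows "runs P' c T' Q'"
  using assms unfolding runs_def by (meson order_trans)

text \<open>The bound \<open>e\<close> is evaluated afresh in every round, so its value has to be
  kept invariant.\<close>

definition For :: "string \<Rightarrow> nexp \<Rightarrow> com \<Rightarrow> com" where
  "For i e c = Seq (NAssign i (NConst 0) (NConst 0))
     (While (NLess (NRead i (NConst 0)) e)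
       (Seq c (NAssign i (NConst 0) (NAdd (NRead i (NConst 0)) (NConst 1)))))"

text \<open>Induction on the rounds left. A round costs the body, \<open>ncost e + 4\<close> for the
  guard and 6 for the increment; the final failing guard costs another
  \<open>ncost e + 4\<close>.\<close>

lemma exec_While_counter:
  assumes body: "\<And>j. j < k \<Longrightarrow> runs (\<lambda>s. I j s \<and> nats s i 0 = j) c T (\<lambda>s. I (Suc j) s \<and> nats s i 0 = j)"
    and bound: "\<And>j s. I j s \<Longrightarrow> nval e s = k"
    and frame: "\<And>j x s. I j s \<Longrightarrow> I j (nwrite i 0 x s)"
    and "I j s" "nats s i 0 = j" "j \<le> k"
  defines "w \<equiv> While (NLess (NRead i (NConst 0)) e)
    (Seq c (NAssign i (NConst 0) (NAdd (NRead i (NConst 0)) (NConst 1))))"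
  shows "\<exists>t s'. exec w s t s' \<and> t \<le> (T + ncost e + 10) * (k - j) + ncost e + 4 \<and> I k s'"
  using assms(4-6)
proof (induction "k - j" arbitrary: j s)
  case 0
  then have "\<not> bval (NLess (NRead i (NConst 0)) e) s" using bound by auto
  from exec.WhileFalse[OF this] show ?case using 0 unfolding w_def by fastforce
next
  case (Suc l)
  then have j: "j < k" by simp
  obtain t1 s1 where 1: "exec c s t1 s1" "t1 \<le> T" "I (Suc j) s1" "nats s1 i 0 = j"
    using body[OF j] Suc.prems unfolding runs_def by blast
  let ?a = "NAssign i (NConst 0) (NAdd (NRead i (NConst 0)) (NConst 1))"
  let ?s2 = "nwrite i 0 (Suc j) s1"
  have "exec ?a s1 (1 + ncost (NConst 0) + ncost (NAdd (NRead i (NConst 0)) (NConst 1))) ?s2"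
    using exec.NAssign[of i "NConst 0" "NAdd (NRead i (NConst 0)) (NConst 1)" s1] 1(4) by simp
  from exec.Seq[OF 1(1) this] have body: "exec (Seq c ?a) s (t1 + 6) ?s2"
    by (simp add: eval_nat_numeral)
  have "I (Suc j) ?s2" by (rule frame[OF 1(3)])
  then obtain t3 s3 where 3: "exec w ?s2 t3 s3"
    "t3 \<le> (T + ncost e + 10) * (k - Suc j) + ncost e + 4" "I k s3"
  proof -
    have "l = k - Suc j" using Suc.hyps(2) by simp
    from Suc.hyps(1)[OF this \<open>I (Suc j) ?s2\<close>] j that show ?thesis by auto
  qed
  have "bval (NLess (NRead i (NConst 0)) e) s" using bound Suc.prems j by simp
  from exec.WhileTrue[OF this body 3(1)[unfolded w_def]]
  have "exec w s (4 + ncost e + (t1 + 6) + t3) s3" by (simp add: w_def)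
  moreover have "4 + ncost e + (t1 + 6) + t3 \<le> (T + ncost e + 10) * (k - j) + ncost e + 4"
  proof -
    have "k - j = Suc (k - Suc j)" using j by simp
    then show ?thesis using 1(2) 3(2) by simp
  qed
  ultimately show ?case using 3(3) by blast
qed

text \<open>The costs are kept in the form \<open>a * N ^ d\<close> so that nested loops only raise the exponent.\<close>

lemma runs_For:
  assumes body: "\<And>j. j < k \<Longrightarrow>
      runs (\<lambda>s. I j s \<and> nats s i 0 = j) c (a * N ^ d) (\<lambda>s. I (Suc j) s \<and> nats s i 0 = j)"
    and bound: "\<And>j s. I j s \<Longrightarrow> nval e s = k"
    and frame: "\<And>j x s. I j s \<Longrightarrow> I j (nwrite i 0 x s)"
    and "k \<le> 2 * N" "1 \<le> N"
  shows "runs (I 0) (For i e c) ((2 * a + 3 * ncost e + 27) * N ^ Suc d) (I k)"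
  unfolding runs_def
proof (intro allI impI)
  fix s assume I: "I 0 s"
  let ?t = "1 + ncost (NConst 0) + ncost (NConst 0)"
  let ?s = "nwrite i 0 0 s"
  have 1: "exec (NAssign i (NConst 0) (NConst 0)) s ?t ?s"
    using exec.NAssign[of i "NConst 0" "NConst 0" s] by simp
  have "\<exists>t s'. exec (While (NLess (NRead i (NConst 0)) e)
      (Seq c (NAssign i (NConst 0) (NAdd (NRead i (NConst 0)) (NConst 1))))) ?s t s' \<and>
      t \<le> (a * N ^ d + ncost e + 10) * (k - 0) + ncost e + 4 \<and> I k s'"
    by (rule exec_While_counter[where I = I, OF body bound frame frame[OF I]]) simp_all
  then obtain t s' where 2: "exec (While (NLess (NRead i (NConst 0)) e)
      (Seq c (NAssign i (NConst 0) (NAdd (NRead i (NConst 0)) (NConst 1))))) ?s t s'"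
    "t \<le> (a * N ^ d + ncost e + 10) * (k - 0) + ncost e + 4" "I k s'"
    by blast
  \<comment> \<open>As \<open>1 \<le> N\<close>, additive constants are absorbed into powers of
    \<open>N\<close>. The factor 2 in \<open>k \<le> 2 * N\<close> makes room for loops over
    \<open>2 * m\<close> outcomes.\<close>
  have "(ncost e + 10) * 1 \<le> (ncost e + 10) * N ^ d"
    using assms(5) by (intro mult_left_mono) auto
  then have "(a * N ^ d + ncost e + 10) * k \<le> (a * N ^ d + (ncost e + 10) * N ^ d) * (2 * N)"
    using assms(4) by (intro mult_mono) auto
  moreover have "(ncost e + 7) * 1 \<le> (ncost e + 7) * N ^ Suc d"
    using assms(5) by (intro mult_mono) auto
  ultimately have "?t + t \<le> (2 * a + 3 * ncost e + 27) * N ^ Suc d"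
    using 2(2) by (simp add: algebra_simps)
  with exec.Seq[OF 1 2(1)] 2(3)
  show "\<exists>t s'. exec (For i e c) s t s' \<and> t \<le> (2 * a + 3 * ncost e + 27) * N ^ Suc d \<and> I k s'"
    unfolding For_def by blast
qed


section \<open>The dynamic program\<close>

abbreviation (input) scalar :: "string \<Rightarrow> nexp" where
  "scalar a \<equiv> NRead a (NConst 0)"

abbreviation (input) set_scalar :: "string \<Rightarrow> nexp \<Rightarrow> com" where
  "set_scalar a e \<equiv> NAssign a (NConst 0) e"

text \<open>
  The nodes of a layer, which have the same number of boxes left to test, are consecutive, and
  layers are built from the last one backwards.  The scalar \<open>layer\<close> is the number of nodes per
  layer, and \<open>fresh\<close> is the address in the previously built layer of the first of the \<open>2 * m\<close>
  nodes at which the box being tested is the best one.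
\<close>

definition prefix_sums :: com where
  "prefix_sums = Seq
     (RAssign ''cum_prob'' (NAdd (scalar ''j'') (NConst 1))
       (RAdd (RRead ''cum_prob'' (scalar ''j'')) (RRead ''prob'' (scalar ''j''))))
     (RAssign ''cum_mean'' (NAdd (scalar ''j'') (NConst 1))
       (RAdd (RRead ''cum_mean'' (scalar ''j''))
         (RMul (RRead ''prob'' (scalar ''j'')) (RRead ''value'' (scalar ''j'')))))"

text \<open>The input values are sorted, so a no to \<open>value[j]\<close> means one of the first
  \<open>j\<close> values: no entries come from prefix sums, yes entries from their complements. For
  \<open>j = 0\<close> the no entry of \<open>mean\<close> is \<open>0 / 0 = 0\<close>, as in
  \<open>cond_mean\<close>.\<close>

definition outcome_tables :: com where
  "outcome_tables =
     Seq (RAssign ''mass'' (scalar ''j'')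
       (RSub (RRead ''cum_prob'' (scalar ''m'')) (RRead ''cum_prob'' (scalar ''j''))))
    (Seq (RAssign ''mass'' (NAdd (scalar ''m'') (scalar ''j'')) (RRead ''cum_prob'' (scalar ''j'')))
    (Seq (RAssign ''mean'' (scalar ''j'')
       (RDiv (RSub (RRead ''cum_mean'' (scalar ''m'')) (RRead ''cum_mean'' (scalar ''j'')))
         (RSub (RRead ''cum_prob'' (scalar ''m'')) (RRead ''cum_prob'' (scalar ''j'')))))
     (RAssign ''mean'' (NAdd (scalar ''m'') (scalar ''j''))
       (RDiv (RRead ''cum_mean'' (scalar ''j'')) (RRead ''cum_prob'' (scalar ''j''))))))"

definition make_leaf :: com where
  "make_leaf =
     Seq (NAssign ''box'' (scalar ''node'') (NAdd (scalar ''b'') (NConst 1)))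
    (Seq (RAssign ''best'' (scalar ''node'') (RRead ''mean'' (scalar ''e'')))
     (set_scalar ''node'' (NAdd (scalar ''node'') (NConst 1))))"

text \<open>\<open>node - layer\<close> is the node with the same best box and outcome in the
  previously built layer. On a tie the old box is kept.\<close>

definition find_successor :: "string \<Rightarrow> nexp \<Rightarrow> com" where
  "find_successor a i =
     Cond (RLess (RRead ''mean'' (scalar ''e'')) (RRead ''mean'' i))
       (set_scalar a (NAdd (scalar ''fresh'') i))
       (set_scalar a (NSub (scalar ''node'') (scalar ''layer'')))"

definition evaluate_threshold :: com where
  "evaluate_threshold =
     Seq (find_successor ''hi'' (scalar ''j''))
    (Seq (find_successor ''lo'' (NAdd (scalar ''m'') (scalar ''j'')))
     (RAssign ''gain'' (NConst 0)
       (RAdd (RMul (RRead ''mass'' (scalar ''j'')) (RRead ''best'' (scalar ''hi'')))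
         (RMul (RRead ''mass'' (NAdd (scalar ''m'') (scalar ''j'')))
           (RRead ''best'' (scalar ''lo''))))))"

text \<open>The first candidate is stored unconditionally, as the node has no computed
  \<open>best\<close> yet.\<close>

definition keep_best :: com where
  "keep_best =
     Cond (BAnd (NLess (NConst 0) (scalar ''j''))
         (RLess (RRead ''gain'' (NConst 0)) (RRead ''best'' (scalar ''node''))))
       Skip
      (Seq (RAssign ''best'' (scalar ''node'') (RRead ''gain'' (NConst 0)))
      (Seq (RAssign ''threshold'' (scalar ''node'') (RRead ''value'' (scalar ''j'')))
      (Seq (NAssign ''yes'' (scalar ''node'') (scalar ''hi''))
       (NAssign ''no'' (scalar ''node'') (scalar ''lo'')))))"

text \<open>The next layer tests the box before, so \<open>fresh\<close> moves one layer ahead and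
  one row of \<open>2 * m\<close> nodes back.\<close>

definition make_layer :: com where
  "make_layer =
     Seq (For ''b'' (scalar ''n'') (For ''e'' (NAdd (scalar ''m'') (scalar ''m''))
       (Seq (For ''j'' (scalar ''m'') (Seq evaluate_threshold keep_best))
         (set_scalar ''node'' (NAdd (scalar ''node'') (NConst 1))))))
     (set_scalar ''fresh''
       (NSub (NAdd (scalar ''fresh'') (scalar ''layer'')) (NAdd (scalar ''m'') (scalar ''m''))))"

text \<open>At the end \<open>node - layer\<close> is the first node of the layer with
  \<open>n\<close> boxes left; adding \<open>m\<close> selects box 1 with outcome \<open>m\<close>,
  whose mean is 0.\<close>

definition dp_program :: com where
  "dp_program =
     Seq (For ''j'' (scalar ''m'') prefix_sums)
    (Seq (For ''j'' (scalar ''m'') outcome_tables)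
    (Seq (For ''b'' (scalar ''n'') (For ''e'' (NAdd (scalar ''m'') (scalar ''m'')) make_leaf))
    (Seq (Seq (set_scalar ''layer'' (scalar ''node''))
       (set_scalar ''fresh'' (NSub (scalar ''layer'') (NAdd (scalar ''m'') (scalar ''m'')))))
    (Seq (For ''k'' (scalar ''n'') make_layer)
     (set_scalar ''start'' (NAdd (NSub (scalar ''node'') (scalar ''layer'')) (scalar ''m'')))))))"

section \<open>Mathematical content of the tables and nodes\<close>

locale threshold_testing = finite_distribution +
  fixes n :: nat
  assumes n_pos: "n \<ge> 1"
begin

definition m :: nat where "m = card (set_pmf F)"

definition v :: "nat \<Rightarrow> real" where "v j = sorted_list_of_set (set_pmf F) ! j"

text \<open>Outcome \<open>j < m\<close> is the answer yes to threshold \<open>v j\<close>, and outcome \<open>m + j\<close> the answer no.\<close>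

definition mass :: "nat \<Rightarrow> real" where
  "mass e = (if e < m then hit F (v e) True else hit F (v (e - m)) False)"

definition mean :: "nat \<Rightarrow> real" where
  "mean e = (if e < m then cond_mean F (v e) True else cond_mean F (v (e - m)) False)"

text \<open>
  The node reached with \<open>k\<close> boxes left to test, if the tested box with the largest conditional mean
  is number \<open>b + 1\<close> and had outcome \<open>e\<close>.
\<close>

definition addr :: "nat \<Rightarrow> nat \<Rightarrow> nat \<Rightarrow> nat" where
  "addr k b e = (k * n + b) * (2 * m) + e"

text \<open>When \<open>k\<close> boxes remain after a test, the box just tested has index
  \<open>n - Suc k\<close>, counted from 0.\<close>

definition successor :: "nat \<Rightarrow> nat \<Rightarrow> nat \<Rightarrow> nat \<Rightarrow> nat" where
  "successor k b e i = (if mean e < mean i then addr k (n - Suc k) i else addr k b e)"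

definition gain :: "nat \<Rightarrow> real \<Rightarrow> nat \<Rightarrow> real" where
  "gain k r j = mass j * bellman F k (max r (mean j)) +
     mass (m + j) * bellman F k (max r (mean (m + j)))"

definition decision :: "state \<Rightarrow> nat \<Rightarrow> nat \<Rightarrow> nat \<Rightarrow> nat \<Rightarrow> bool" where
  "decision s k b e j \<longleftrightarrow> (let q = addr (Suc k) b e in
     reals s ''threshold'' q = v j \<and>
     nats s ''yes'' q = successor k b e j \<and> nats s ''no'' q = successor k b e (m + j))"

definition node_correct :: "state \<Rightarrow> nat \<Rightarrow> nat \<Rightarrow> nat \<Rightarrow> bool" where
  "node_correct s k b e \<longleftrightarrow>
     reals s ''best'' (addr k b e) = bellman F k (mean e) \<and>
     (case k of 0 \<Rightarrow> nats s ''box'' (addr k b e) = Suc b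
      | Suc k' \<Rightarrow> \<exists>j<m. gain k' (mean e) j = bellman F k (mean e) \<and> decision s k' b e j)"

definition nodes_correct :: "nat \<Rightarrow> state \<Rightarrow> bool" where
  "nodes_correct q s \<longleftrightarrow>
     (\<forall>k b e. b < n \<longrightarrow> e < 2 * m \<longrightarrow> addr k b e < q \<longrightarrow> node_correct s k b e)"

section \<open>Prefix sums over the sorted support\<close>

lemma m_pos: "m \<ge> 1"
  unfolding m_def using finite_support set_pmf_not_empty[of F] by (simp add: Suc_le_eq card_gt_0_iff)

lemma set_pmf_eq_image: "set_pmf F = v ` {..<m}"
proof -
  have "set (sorted_list_of_set (set_pmf F)) = v ` {..<length (sorted_list_of_set (set_pmf F))}"
    unfolding v_def by (auto simp: set_conv_nth)
  then show ?thesis using finite_support by (simp add: m_def)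
qed

lemma v_less_iff: "i < m \<Longrightarrow> j < m \<Longrightarrow> v i < v j \<longleftrightarrow> i < j"
  unfolding v_def m_def
  using strict_sorted_list_of_set[of "set_pmf F"] finite_support
  by (metis length_sorted_list_of_set linorder_neqE_nat order_less_asym order_less_irrefl
      sorted_wrt_nth_less)

lemma inj_on_v: "inj_on v {..<m}"
  by (rule inj_onI) (metis lessThan_iff linorder_neqE_nat order_less_irrefl v_less_iff)

lemma expectation_eq_sum: "measure_pmf.expectation F f = (\<Sum>l<m. pmf F (v l) * f (v l))"
  for f :: "real \<Rightarrow> real"
  unfolding expectation_F set_pmf_eq_image by (subst sum.reindex[OF inj_on_v]) simp

text \<open>As \<open>v\<close> is increasing, the indices answering no to threshold
  \<open>v j\<close> are exactly those below \<open>j\<close>.\<close>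

lemma split_sum_at:
  assumes "j < m"
  shows "(\<Sum>l<m. (f l :: real) * of_bool ((v l \<ge> v j) = y)) =
    (if y then (\<Sum>l<m. f l) - (\<Sum>l<j. f l) else (\<Sum>l<j. f l))"
proof -
  have no: "(\<Sum>l<m. f l * of_bool (\<not> v l \<ge> v j)) = (\<Sum>l<j. f l)"
  proof -
    have "(\<Sum>l<m. f l * of_bool (\<not> v l \<ge> v j)) = (\<Sum>l<m. if l \<in> {..<j} then f l else 0)"
      using assms by (intro sum.cong) (auto simp: v_less_iff not_le)
    also have "\<dots> = (\<Sum>l\<in>{..<m} \<inter> {..<j}. f l)" by (subst sum.inter_restrict) auto
    also have "{..<m} \<inter> {..<j} = {..<j}" using assms by auto
    finally show ?thesis .
  qed
  have "(\<Sum>l<m. f l * of_bool (v l \<ge> v j)) + (\<Sum>l<m. f l * of_bool (\<not> v l \<ge> v j)) = (\<Sum>l<m. f l)"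
    unfolding sum.distrib[symmetric] by (intro sum.cong) auto
  with no show ?thesis by auto
qed

lemma hit_eq_prefix_sum:
  assumes "j < m"
  shows "hit F (v j) y =
    (if y then (\<Sum>l<m. pmf F (v l)) - (\<Sum>l<j. pmf F (v l)) else (\<Sum>l<j. pmf F (v l)))"
  unfolding hit_def expectation_eq_sum by (rule split_sum_at[OF assms])

lemma partial_mean_eq_prefix_sum:
  assumes "j < m"
  shows "partial_mean F (v j) y =
    (if y then (\<Sum>l<m. pmf F (v l) * v l) - (\<Sum>l<j. pmf F (v l) * v l)
     else (\<Sum>l<j. pmf F (v l) * v l))"
  unfolding partial_mean_def expectation_eq_sum mult.assoc[symmetric] by (rule split_sum_at[OF assms])

lemma bellman_Suc_eq_Max_gain: "bellman F (Suc k) r = Max (gain k r ` {..<m})"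
  unfolding bellman.simps set_pmf_eq_image image_image
  by (intro arg_cong[of _ _ Max] image_cong) (auto simp: gain_def mass_def mean_def UNIV_bool)

lemma mean_nonneg: "mean e \<ge> 0"
  by (simp add: mean_def cond_mean_nonneg)

text \<open>
  The smallest value as threshold is never answered no, and the mean of this outcome is \<open>0 / 0 = 0\<close>:
  so outcome \<open>m\<close> can stand for having tested no box yet.
\<close>

lemma mean_initial: "mean m = 0"
proof -
  have "partial_mean F (v 0) False = 0"
    using m_pos by (subst partial_mean_eq_prefix_sum) auto
  then show ?thesis by (simp add: mean_def cond_mean_def)
qed

section \<open>Node addresses\<close>

lemma addr_Suc: "addr (Suc k) b e = addr k b e + n * (2 * m)"
  by (simp add: addr_def algebra_simps)

text \<open>Layers do not overlap, so the nodes that a transition leads to are filled in before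
  it.\<close>

lemma addr_less: "b' < n \<Longrightarrow> e' < 2 * m \<Longrightarrow> addr k b' e' < addr (Suc k) b e"
proof -
  assume "b' < n" "e' < 2 * m"
  then have "(Suc b') * (2 * m) \<le> n * (2 * m)" by (intro mult_right_mono) auto
  with \<open>e' < 2 * m\<close> show ?thesis by (simp add: addr_def algebra_simps)
qed

text \<open>Division with remainder by \<open>2 * m\<close> recovers \<open>e\<close>, then by
  \<open>n\<close> it recovers \<open>k\<close> and \<open>b\<close>.\<close>

lemma addr_inject:
  assumes "b < n" "e < 2 * m" "b' < n" "e' < 2 * m" "addr k b e = addr k' b' e'"
  shows "k = k' \<and> b = b' \<and> e = e'"
proof -
  have "(k * n + b) * (2 * m) + e = (k' * n + b') * (2 * m) + e'"
    using assms(5) by (simp add: addr_def)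
  from arg_cong[OF this, of "\<lambda>x. x div (2 * m)"] arg_cong[OF this, of "\<lambda>x. x mod (2 * m)"]
  have e: "k * n + b = k' * n + b'" "e = e'" using assms by auto
  from arg_cong[OF e(1), of "\<lambda>x. x div n"] arg_cong[OF e(1), of "\<lambda>x. x mod n"]
  show ?thesis using assms e(2) by auto
qed

lemma nodes_correct_Suc:
  assumes "nodes_correct q s" "node_correct s k b e" "addr k b e = q" "b < n" "e < 2 * m"
  shows "nodes_correct (Suc q) s"
  unfolding nodes_correct_def
proof (intro allI impI)
  fix k' b' e' assume *: "b' < n" "e' < 2 * m" "addr k' b' e' < Suc q"
  show "node_correct s k' b' e'"
  proof (cases "addr k' b' e' = q")
    case True
    then show ?thesis using addr_inject assms * by metis
  next
    case False
    then show ?thesis using * assms(1) by (simp add: nodes_correct_def)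
  qed
qed

text \<open>Frame rule: the correctness of a node reads only entries at its own address, so writes
  at \<open>q\<close> or above preserve it.\<close>

lemma nodes_correct_cong:
  assumes "nodes_correct q s"
    and "\<And>i. i < q \<Longrightarrow> reals s' ''best'' i = reals s ''best'' i \<and>
      reals s' ''threshold'' i = reals s ''threshold'' i \<and> nats s' ''yes'' i = nats s ''yes'' i \<and>
      nats s' ''no'' i = nats s ''no'' i \<and> nats s' ''box'' i = nats s ''box'' i"
  shows "nodes_correct q s'"
proof -
  have "node_correct s' k b e = node_correct s k b e" if "addr k b e < q" for k b e
    using assms(2)[OF that] by (cases k) (simp_all add: node_correct_def decision_def Let_def)
  then show ?thesis using assms(1) by (simp add: nodes_correct_def)
qed


section \<open>Optimality of the automaton\<close>

definition outcome :: "bool \<Rightarrow> nat \<Rightarrow> nat" where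
  "outcome y j = (if y then j else m + j)"

lemma mean_outcome: "j < m \<Longrightarrow> mean (outcome y j) = cond_mean F (v j) y"
  by (cases y) (auto simp: outcome_def mean_def)

lemma gain_eq:
  "j < m \<Longrightarrow>
     gain k r j = (\<Sum>y\<in>UNIV. hit F (v j) y * bellman F k (max r (mean (outcome y j))))"
  by (simp add: gain_def mass_def outcome_def UNIV_bool)

text \<open>\<open>addr (Suc n) 0 0\<close> is the first address past the layer with
  \<open>n\<close> boxes left.\<close>

definition automaton_correct :: "state \<Rightarrow> bool" where
  "automaton_correct s \<longleftrightarrow>
     nats s ''start'' 0 = addr n 0 m \<and> nodes_correct (addr (Suc n) 0 0) s"

lemma automaton_node_correct:
  assumes "automaton_correct s" "k \<le> n" "b < n" "e < 2 * m"
  shows "node_correct s k b e"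
proof -
  have "addr k b e < addr (Suc k) 0 0" using assms by (intro addr_less)
  also have "\<dots> \<le> addr (Suc n) 0 0" using assms(2) by (simp add: addr_def)
  finally show ?thesis using assms by (simp add: automaton_correct_def nodes_correct_def)
qed

text \<open>
  The mean stored at a node never exceeds the true conditional mean of the box stored there; it may
  be smaller, as box 1 is stored with mean 0 before any test.
\<close>

definition tracks :: "state \<Rightarrow> bool list \<Rightarrow> nat \<Rightarrow> nat \<Rightarrow> bool" where
  "tracks s h b e \<longleftrightarrow> b < n \<and> e < 2 * m \<and> node_after s h = addr (n - length h) b e \<and>
     (if b < length h then mean e \<le> box_mean F (output_algorithm s) h b else mean e \<le> 0)"

text \<open>The stored threshold attains the Bellman maximum, and the transition replaces the mean
  by its maximum with that of the new outcome, so the automaton follows the Bellman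
  recursion.\<close>

lemma tracks_step:
  assumes s: "automaton_correct s" and t: "tracks s h b e" and k: "n - length h = Suc k"
  obtains j where "j < m" "threshold (output_algorithm s) h = v j"
    "gain k (mean e) j = bellman F (Suc k) (mean e)"
    "\<And>y. \<exists>b' e'. tracks s (h @ [y]) b' e' \<and> mean e' = max (mean e) (mean (outcome y j))"
proof -
  let ?A = "output_algorithm s"
  have be: "b < n" "e < 2 * m" and node: "node_after s h = addr (Suc k) b e"
    and le: "if b < length h then mean e \<le> box_mean F ?A h b else mean e \<le> 0"
    using t k by (auto simp: tracks_def)
  have nl: "n - Suc k = length h" "n - Suc (length h) = k" using k by simp_all
  have "node_correct s (Suc k) b e"
    using automaton_node_correct[OF s, of "Suc k"] be k by simp
  then obtain j where j: "j < m" "gain k (mean e) j = bellman F (Suc k) (mean e)"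
    "decision s k b e j"
    by (auto simp: node_correct_def)
  have threshold: "threshold ?A h = v j"
    using j(3) node by (simp add: output_algorithm_def decision_def Let_def)
  have "\<exists>b' e'. tracks s (h @ [y]) b' e' \<and> mean e' = max (mean e) (mean (outcome y j))" for y
  proof -
    let ?o = "outcome y j"
    have "node_after s (h @ [y]) = nats s (if y then ''yes'' else ''no'') (node_after s h)"
      by (simp add: node_after_def)
    then have node': "node_after s (h @ [y]) = successor k b e ?o"
      using j(3) by (simp add: node outcome_def decision_def Let_def)
    have o: "?o < 2 * m" using j(1) by (auto simp: outcome_def)
    have last: "box_mean F ?A (h @ [y]) (length h) = mean ?o"
      using threshold j(1) by (simp add: mean_outcome)
    show ?thesis
    proof (cases "mean e < mean ?o")
      case True
      then have "tracks s (h @ [y]) (length h) ?o"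
        using k node' o last nl by (auto simp: tracks_def successor_def)
      then show ?thesis using True by (intro exI[of _ "length h"] exI[of _ ?o]) auto
    next
      case False
      \<comment> \<open>The stored box may be the one just tested, if it was stored with mean at
        most 0; its new conditional mean is at least that.\<close>
      consider "b < length h" | "b = length h" | "b > length h" by linarith
      then have "tracks s (h @ [y]) b e"
      proof cases
        case 2
        then have "mean e \<le> mean ?o" using le mean_nonneg[of ?o] by simp
        then show ?thesis using 2 k node' be last False nl by (simp add: tracks_def successor_def)
      qed (use k node' be le False nl in \<open>simp_all add: tracks_def successor_def\<close>)
      then show ?thesis using False by (intro exI[of _ b] exI[of _ e]) auto
    qed
  qed
  with j threshold show ?thesis using that by blast
qed

lemma tracks_exists:
  assumes s: "automaton_correct s"
  shows "length h \<le> n \<Longrightarrow> \<exists>b e. tracks s h b e"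
proof (induction h rule: rev_induct)
  case Nil
  have "tracks s [] 0 m"
    using s n_pos m_pos by (simp add: tracks_def automaton_correct_def node_after_def mean_initial)
  then show ?case by blast
next
  case (snoc y h)
  then obtain b e where "tracks s h b e" by auto
  moreover have "n - length h = Suc (n - Suc (length h))" using snoc.prems by simp
  ultimately show ?case using tracks_step[OF s] by metis
qed

lemma choice_tracked:
  assumes "automaton_correct s" "tracks s h b e" "length h = n"
  shows "choice (output_algorithm s) h = Suc b"
  using automaton_node_correct[OF assms(1), of 0 b e] assms(2,3)
  by (simp add: tracks_def node_correct_def output_algorithm_def)

lemma v_nonneg: "j < m \<Longrightarrow> v j \<ge> 0"
  using set_pmf_eq_image support_nonneg by auto

lemma valid_output:
  assumes s: "automaton_correct s"
  shows "valid n (output_algorithm s)"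
  unfolding valid_def
proof (intro conjI allI impI)
  fix h :: "bool list" assume h: "length h < n"
  then obtain b e where "tracks s h b e" using tracks_exists[OF s, of h] by auto
  moreover have "n - length h = Suc (n - Suc (length h))" using h by simp
  ultimately show "0 \<le> threshold (output_algorithm s) h"
    using tracks_step[OF s] v_nonneg by metis
next
  fix h :: "bool list" assume h: "length h = n"
  then obtain b e where "tracks s h b e" using tracks_exists[OF s, of h] by auto
  then show "choice (output_algorithm s) h \<in> {1..n}"
    using choice_tracked[OF s _ h] by (auto simp: tracks_def)
qed

text \<open>Counterpart of \<open>history_value_le_bellman\<close>: at the end the stored mean is at
  most that of the chosen box, and before that the stored threshold attains the maximum.\<close>

lemma bellman_le_history_value:
  assumes s: "automaton_correct s"
  shows "tracks s h b e \<Longrightarrow> length h + k = n \<Longrightarrow> bellman F k (mean e) \<le>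
    history_value F (output_algorithm s)
      (\<lambda>h. box_mean F (output_algorithm s) h (choice (output_algorithm s) h - 1)) k h"
proof (induction k arbitrary: h b e)
  case 0
  then show ?case using choice_tracked[OF s, of h b e] by (simp add: tracks_def)
next
  case (Suc k)
  have k: "n - length h = Suc k" using Suc.prems(2) by simp
  from tracks_step[OF s Suc.prems(1) k] obtain j where j: "j < m"
    "threshold (output_algorithm s) h = v j" "gain k (mean e) j = bellman F (Suc k) (mean e)"
    "\<And>y. \<exists>b' e'. tracks s (h @ [y]) b' e' \<and> mean e' = max (mean e) (mean (outcome y j))"
    by metis
  have "bellman F k (max (mean e) (mean (outcome y j))) \<le>
      history_value F (output_algorithm s)
        (\<lambda>h. box_mean F (output_algorithm s) h (choice (output_algorithm s) h - 1)) k (h @ [y])" for y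
  proof -
    obtain b' e' where "tracks s (h @ [y]) b' e'" "mean e' = max (mean e) (mean (outcome y j))"
      using j(4) by blast
    then show ?thesis using Suc.IH[of "h @ [y]" b' e'] Suc.prems(2) by simp
  qed
  then show ?case
    unfolding j(3)[symmetric] gain_eq[OF j(1)] history_value.simps j(2)
    by (intro sum_mono mult_left_mono hit_nonneg)
qed

lemma optimal_output:
  assumes s: "automaton_correct s"
  shows "optimal n F (output_algorithm s)"
proof -
  have "tracks s [] 0 m"
    using s n_pos m_pos by (simp add: tracks_def automaton_correct_def node_after_def mean_initial)
  from bellman_le_history_value[OF s this, of n]
  have "bellman F n 0 \<le> expected_reward n F (output_algorithm s)"
    by (simp add: expected_reward_eq_history_value[OF valid_output[OF s]] mean_initial)
  then show ?thesis
    unfolding optimal_def using valid_output[OF s] expected_reward_le_bellman order_trans by blast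
qed


section \<open>Correctness and running time of the program\<close>

definition tables :: "state \<Rightarrow> bool" where
  "tables s \<longleftrightarrow> nats s ''n'' 0 = n \<and> nats s ''m'' 0 = m \<and>
     (\<forall>j<m. reals s ''value'' j = v j) \<and>
     (\<forall>e<2 * m. reals s ''mass'' e = mass e \<and> reals s ''mean'' e = mean e)"

text \<open>\<open>(k, b, e)\<close> is the next node to build. \<open>layer\<close> is set after
  the leaves, hence the guard \<open>0 < k\<close>; \<open>fresh\<close> is the row of the box being
  tested, \<open>n - k\<close>, in the layer below.\<close>

definition layer_inv :: "nat \<Rightarrow> nat \<Rightarrow> nat \<Rightarrow> state \<Rightarrow> bool" where
  "layer_inv k b e s \<longleftrightarrow> tables s \<and>
     nats s ''node'' 0 = addr k b e \<and> nodes_correct (addr k b e) s \<and>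
     (0 < k \<longrightarrow> nats s ''layer'' 0 = n * (2 * m)) \<and>
     (0 < k \<and> k \<le> n \<longrightarrow> nats s ''fresh'' 0 = addr (k - 1) (n - k) 0)"

lemma layer_inv_nwrite [simp]:
  assumes "a \<notin> {''n'', ''m'', ''node'', ''layer'', ''fresh'', ''yes'', ''no'', ''box''}"
  shows "layer_inv k b e (nwrite a i x s) = layer_inv k b e s"
proof -
  have "node_correct (nwrite a i x s) k b e = node_correct s k b e" for k b e
    using assms by (cases k) (simp_all add: node_correct_def decision_def Let_def)
  then show ?thesis using assms by (simp add: layer_inv_def tables_def nodes_correct_def)
qed

lemma layer_inv_rwrite_gain [simp]:
  "layer_inv k b e (rwrite ''gain'' i x s) = layer_inv k b e s"
proof -
  have "node_correct (rwrite ''gain'' i x s) k b e = node_correct s k b e" for k b e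
    by (cases k) (simp_all add: node_correct_def decision_def Let_def)
  then show ?thesis by (simp add: layer_inv_def tables_def nodes_correct_def)
qed

lemma layer_inv_params:
  "layer_inv k b e s \<Longrightarrow> nats s ''n'' 0 = n"
  "layer_inv k b e s \<Longrightarrow> nats s ''m'' 0 = m"
  by (simp_all add: layer_inv_def tables_def)

lemma decision_nwrite [simp]:
  "a \<notin> {''yes'', ''no''} \<Longrightarrow> decision (nwrite a i x s) k b e j = decision s k b e j"
  by (simp add: decision_def Let_def)

lemma run_find_successor:
  assumes "layer_inv (Suc k) b e s" "nats s ''e'' 0 = e" "e < 2 * m" "k < n"
    and "nval i s = i'" "i' < 2 * m"
  shows "run (find_successor a i) s = nwrite a 0 (successor k b e i') s"
proof -
  have "reals s ''mean'' e = mean e" "reals s ''mean'' i' = mean i'"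
    "nats s ''node'' 0 - nats s ''layer'' 0 = addr k b e"
    "nats s ''fresh'' 0 + i' = addr k (n - Suc k) i'"
    using assms by (simp_all add: layer_inv_def tables_def addr_Suc addr_def[of k "n - Suc k"])
  then show ?thesis using assms by (simp add: find_successor_def successor_def)
qed

text \<open>Both possible successors lie in the finished layer \<open>k\<close>, and the comparison
  of means implements the maximum.\<close>

lemma best_successor:
  assumes "layer_inv (Suc k) b e s" "b < n" "e < 2 * m" "k < n" "i < 2 * m"
  shows "reals s ''best'' (successor k b e i) = bellman F k (max (mean e) (mean i))"
proof -
  have "nodes_correct (addr (Suc k) b e) s" using assms(1) by (simp add: layer_inv_def)
  then have "reals s ''best'' (addr k b' e') = bellman F k (mean e')" if "b' < n" "e' < 2 * m" for b' e'
    using that addr_less[OF that] by (simp add: nodes_correct_def node_correct_def)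
  then show ?thesis using assms by (auto simp: successor_def max_def)
qed

lemma run_evaluate_threshold:
  assumes s: "layer_inv (Suc k) b e s" "nats s ''e'' 0 = e" "nats s ''j'' 0 = j"
    and "b < n" "e < 2 * m" "k < n" "j < m"
  shows "run evaluate_threshold s = rwrite ''gain'' 0 (gain k (mean e) j)
    (nwrite ''lo'' 0 (successor k b e (m + j)) (nwrite ''hi'' 0 (successor k b e j) s))"
proof -
  let ?s1 = "nwrite ''hi'' 0 (successor k b e j) s"
  let ?s2 = "nwrite ''lo'' 0 (successor k b e (m + j)) ?s1"
  have m: "nats s ''m'' 0 = m" and mass: "\<And>i. i < 2 * m \<Longrightarrow> reals s ''mass'' i = mass i"
    using s(1) by (auto simp: layer_inv_def tables_def)
  have "run (find_successor ''hi'' (scalar ''j'')) s = ?s1"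
    using assms by (intro run_find_successor) auto
  moreover have "run (find_successor ''lo'' (NAdd (scalar ''m'') (scalar ''j''))) ?s1 = ?s2"
    using assms m by (intro run_find_successor) auto
  ultimately show ?thesis
    using assms m by (simp add: evaluate_threshold_def gain_def mass best_successor)
qed

text \<open>The node records a maximizer of \<open>gain\<close> among the first \<open>j\<close>
  thresholds; before the first one nothing is claimed.\<close>

definition candidate_inv :: "nat \<Rightarrow> nat \<Rightarrow> nat \<Rightarrow> nat \<Rightarrow> state \<Rightarrow> bool" where
  "candidate_inv k b e j s \<longleftrightarrow> layer_inv (Suc k) b e s \<and>
     nats s ''e'' 0 = e \<and> nats s ''b'' 0 = b \<and> nats s ''k'' 0 = k \<and>
     (0 < j \<longrightarrow> (\<exists>i<j. reals s ''best'' (addr (Suc k) b e) = gain k (mean e) i \<and>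
       decision s k b e i \<and> (\<forall>i'<j. gain k (mean e) i' \<le> gain k (mean e) i)))"

lemma candidate_inv_step:
  assumes s: "candidate_inv k b e j s" "nats s ''j'' 0 = j"
    and less: "b < n" "e < 2 * m" "k < n" "j < m"
  defines "s' \<equiv> run (Seq evaluate_threshold keep_best) s"
  shows "candidate_inv k b e (Suc j) s' \<and> nats s' ''j'' 0 = j"
proof -
  let ?q = "addr (Suc k) b e" and ?g = "gain k (mean e)"
  have inv: "layer_inv (Suc k) b e s" "nats s ''e'' 0 = e" "nats s ''b'' 0 = b" "nats s ''k'' 0 = k"
    using s(1) by (simp_all add: candidate_inv_def)
  then have node: "nats s ''node'' 0 = ?q" and v: "reals s ''value'' j = v j"
    using less by (simp_all add: layer_inv_def tables_def)
  let ?hi = "successor k b e j" and ?lo = "successor k b e (m + j)"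
  let ?s1 = "rwrite ''gain'' 0 (?g j) (nwrite ''lo'' 0 ?lo (nwrite ''hi'' 0 ?hi s))"
  have s': "s' = run keep_best ?s1"
    unfolding s'_def run.simps run_evaluate_threshold[OF inv(1,2) s(2) less] ..
  show ?thesis
  proof (cases "0 < j \<and> ?g j < reals s ''best'' ?q")
    case True
    then have "s' = ?s1" using s(2) node by (simp add: s' keep_best_def)
    moreover obtain i where "i < j" "reals s ''best'' ?q = ?g i" "decision s k b e i"
      "\<forall>i'<j. ?g i' \<le> ?g i"
      using True s(1) by (auto simp: candidate_inv_def)
    ultimately show ?thesis using True inv s(2)
      by (auto simp: candidate_inv_def decision_def Let_def less_Suc_eq intro!: exI[of _ i])
  next
    case False
    then have eq: "s' = nwrite ''no'' ?q ?lo (nwrite ''yes'' ?q ?hi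
        (rwrite ''threshold'' ?q (v j) (rwrite ''best'' ?q (?g j) ?s1)))"
      using s(2) node v by (auto simp: s' keep_best_def)
    \<comment> \<open>All writes go to address \<open>?q\<close> or to scratch scalars, so the nodes
      below \<open>?q\<close> are untouched.\<close>
    have "nodes_correct ?q s'"
      by (rule nodes_correct_cong[of _ s]) (use inv(1) in \<open>auto simp: layer_inv_def eq\<close>)
    then have "layer_inv (Suc k) b e s'"
      using inv(1) by (simp add: layer_inv_def tables_def eq)
    moreover have "?g i' \<le> ?g j" if "i' < j" for i'
      using False that s(1) by (fastforce simp: candidate_inv_def)
    ultimately show ?thesis using inv s(2)
      by (auto simp: candidate_inv_def decision_def Let_def less_Suc_eq eq intro!: exI[of _ j])
  qed
qed

lemma candidate_inv_final:
  assumes "candidate_inv k b e m s"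
  shows "node_correct s (Suc k) b e"
proof -
  obtain i where i: "i < m" "reals s ''best'' (addr (Suc k) b e) = gain k (mean e) i"
    "decision s k b e i" "\<forall>i'<m. gain k (mean e) i' \<le> gain k (mean e) i"
    using assms m_pos by (auto simp: candidate_inv_def)
  have "bellman F (Suc k) (mean e) = gain k (mean e) i"
    unfolding bellman_Suc_eq_Max_gain using i by (intro Max_eqI) auto
  with i show ?thesis by (auto simp: node_correct_def)
qed

section \<open>Invariants and time bounds of the nested loops\<close>

lemma addr_end_row: "addr k b (2 * m) = addr k (Suc b) 0"
  by (simp add: addr_def)

lemma addr_end_layer: "addr k n 0 = addr (Suc k) 0 0"
  by (simp add: addr_def algebra_simps)

lemma layer_inv_next:
  assumes "layer_inv k b e s" "node_correct s k b e" "b < n" "e < 2 * m"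
  shows "layer_inv k b (Suc e) (nwrite ''node'' 0 (Suc (nats s ''node'' 0)) s)"
proof -
  have addr: "addr k b (Suc e) = Suc (addr k b e)" by (simp add: addr_def)
  have "nodes_correct (Suc (addr k b e)) s"
    using assms by (intro nodes_correct_Suc) (auto simp: layer_inv_def)
  then show ?thesis
    using assms(1) nodes_correct_cong[of _ s] unfolding layer_inv_def tables_def addr by simp
qed

definition N :: nat where "N = n + m"

lemma bounds: "1 \<le> N" "Suc 0 \<le> N" "n \<le> 2 * N" "m \<le> 2 * N" "m \<le> N"
  "m + m \<le> N + N" "n \<le> N + N"
  using n_pos by (simp_all add: N_def)

lemma runs_candidates:
  assumes "b < n" "e < 2 * m" "k < n"
  shows "runs (candidate_inv k b e 0) (For ''j'' (scalar ''m'') (Seq evaluate_threshold keep_best))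
    (433 * N ^ 1) (candidate_inv k b e m)"
\<comment> \<open>The body costs at most 200 steps and the expression for the loop bound 2, so
  \<open>runs_For\<close> gives \<open>433 = 2 * 200 + 3 * 2 + 27\<close>. The later constants arise
  likewise, some rounded up.\<close>
proof (rule runs_weaken[OF runs_For[where I = "candidate_inv k b e" and a = 200 and d = 0 and N = N
      and k = m]])
  fix j assume j: "j < m"
  show "runs (\<lambda>s. candidate_inv k b e j s \<and> nats s ''j'' 0 = j) (Seq evaluate_threshold keep_best)
      (200 * N ^ 0) (\<lambda>s. candidate_inv k b e (Suc j) s \<and> nats s ''j'' 0 = j)"
  proof (rule runs_loop_free)
    fix s assume "candidate_inv k b e j s \<and> nats s ''j'' 0 = j"
    then show "candidate_inv k b e (Suc j) (run (Seq evaluate_threshold keep_best) s) \<and>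
        nats (run (Seq evaluate_threshold keep_best) s) ''j'' 0 = j"
      using candidate_inv_step assms j by blast
  qed (simp_all add: evaluate_threshold_def keep_best_def find_successor_def)
qed (use layer_inv_params in \<open>auto simp: bounds candidate_inv_def\<close>)

abbreviation (input) make_node :: com where
  "make_node \<equiv> Seq (For ''j'' (scalar ''m'') (Seq evaluate_threshold keep_best))
     (set_scalar ''node'' (NAdd (scalar ''node'') (NConst 1)))"

lemma runs_make_node:
  assumes "b < n" "e < 2 * m" "k < n"
  shows "runs (\<lambda>s. (layer_inv (Suc k) b e s \<and> nats s ''b'' 0 = b \<and> nats s ''k'' 0 = k) \<and>
      nats s ''e'' 0 = e)
    make_node (439 * N ^ 1)
    (\<lambda>s. (layer_inv (Suc k) b (Suc e) s \<and> nats s ''b'' 0 = b \<and> nats s ''k'' 0 = k) \<and>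
      nats s ''e'' 0 = e)"
proof (rule runs_weaken[OF runs_Seq[OF runs_candidates[OF assms] runs_loop_free[where T = 6]]])
  fix s assume s: "candidate_inv k b e m s"
  let ?s = "run (set_scalar ''node'' (NAdd (scalar ''node'') (NConst 1))) s"
  show "(layer_inv (Suc k) b (Suc e) ?s \<and> nats ?s ''b'' 0 = b \<and> nats ?s ''k'' 0 = k) \<and>
      nats ?s ''e'' 0 = e"
    using s layer_inv_next[OF _ candidate_inv_final[OF s] assms(1,2)]
    by (simp add: candidate_inv_def)
qed (use bounds(1) in \<open>auto simp: candidate_inv_def\<close>)

lemma runs_make_row:
  assumes "b < n" "k < n"
  shows "runs (\<lambda>s. (layer_inv (Suc k) b 0 s \<and> nats s ''k'' 0 = k) \<and> nats s ''b'' 0 = b)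
    (For ''e'' (NAdd (scalar ''m'') (scalar ''m'')) make_node) (920 * N ^ 2)
    (\<lambda>s. (layer_inv (Suc k) (Suc b) 0 s \<and> nats s ''k'' 0 = k) \<and> nats s ''b'' 0 = b)"
proof (rule runs_weaken[OF runs_For[where k = "2 * m" and a = 439 and d = 1 and N = N
      and I = "\<lambda>e s. layer_inv (Suc k) b e s \<and> nats s ''b'' 0 = b \<and> nats s ''k'' 0 = k"]])
  fix e assume "e < 2 * m"
  then show "runs (\<lambda>s. (layer_inv (Suc k) b e s \<and> nats s ''b'' 0 = b \<and> nats s ''k'' 0 = k) \<and>
      nats s ''e'' 0 = e) make_node (439 * N ^ 1)
    (\<lambda>s. (layer_inv (Suc k) b (Suc e) s \<and> nats s ''b'' 0 = b \<and> nats s ''k'' 0 = k) \<and>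
      nats s ''e'' 0 = e)"
    using assms by (intro runs_make_node)
next
  fix s assume "layer_inv (Suc k) b (2 * m) s \<and> nats s ''b'' 0 = b \<and> nats s ''k'' 0 = k"
  then show "(layer_inv (Suc k) (Suc b) 0 s \<and> nats s ''k'' 0 = k) \<and> nats s ''b'' 0 = b"
    by (simp add: layer_inv_def addr_end_row)
qed (use layer_inv_params in \<open>auto simp: bounds power2_eq_square\<close>)

lemma runs_make_layer:
  assumes "k < n"
  shows "runs (\<lambda>s. layer_inv (Suc k) 0 0 s \<and> nats s ''k'' 0 = k) make_layer (1900 * N ^ 3)
    (\<lambda>s. layer_inv (Suc (Suc k)) 0 0 s \<and> nats s ''k'' 0 = k)"
  unfolding make_layer_def
proof (rule runs_weaken[OF runs_Seq[OF
      runs_For[where k = n and a = 920 and d = 2 and N = N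
        and I = "\<lambda>b s. layer_inv (Suc k) b 0 s \<and> nats s ''k'' 0 = k"]
      runs_loop_free[where T = 20]]])
  fix b assume "b < n"
  then show "runs (\<lambda>s. (layer_inv (Suc k) b 0 s \<and> nats s ''k'' 0 = k) \<and> nats s ''b'' 0 = b)
    (For ''e'' (NAdd (scalar ''m'') (scalar ''m'')) make_node) (920 * N ^ 2)
    (\<lambda>s. (layer_inv (Suc k) (Suc b) 0 s \<and> nats s ''k'' 0 = k) \<and> nats s ''b'' 0 = b)"
    using assms by (intro runs_make_row)
next
  let ?c = "set_scalar ''fresh''
    (NSub (NAdd (scalar ''fresh'') (scalar ''layer'')) (NAdd (scalar ''m'') (scalar ''m'')))"
  fix s assume s: "layer_inv (Suc k) n 0 s \<and> nats s ''k'' 0 = k"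
  \<comment> \<open>If another layer follows, its \<open>fresh\<close> row belongs to the preceding
    box: one layer ahead, one row back.\<close>
  have "addr k (n - Suc k) 0 + n * (2 * m) - (m + m) = addr (Suc k) (n - Suc (Suc k)) 0"
    if "Suc k < n"
  proof -
    have "(k * n + Suc r) * (2 * m) + n * (2 * m) = (Suc k * n + r) * (2 * m) + (m + m)" for r
      by (simp add: algebra_simps)
    moreover have "n - Suc k = Suc (n - Suc (Suc k))" using that by simp
    ultimately show ?thesis by (simp only: addr_def add_0_right diff_add_inverse2)
  qed
  moreover have "nodes_correct q (run ?c s) = nodes_correct q s" for q
    by (auto intro: nodes_correct_cong)
  ultimately show "layer_inv (Suc (Suc k)) 0 0 (run ?c s) \<and> nats (run ?c s) ''k'' 0 = k"
    using s assms by (simp add: layer_inv_def tables_def addr_end_layer)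
next
  have "20 \<le> 20 * N ^ 3" using bounds(1) by simp
  then show "(2 * 920 + 3 * ncost (scalar ''n'') + 27) * N ^ Suc 2 + 20 \<le> 1900 * N ^ 3"
    by simp
qed (use layer_inv_params in \<open>auto simp: bounds\<close>)

lemma runs_make_leaves:
  "runs (layer_inv 0 0 0)
    (For ''b'' (scalar ''n'') (For ''e'' (NAdd (scalar ''m'') (scalar ''m'')) make_leaf))
    (400 * N ^ 2) (layer_inv 0 n 0)"
proof (rule runs_weaken[OF runs_For[where k = n and a = 150 and d = 1 and N = N
      and I = "\<lambda>b. layer_inv 0 b 0"]])
  fix b assume b: "b < n"
  show "runs (\<lambda>s. layer_inv 0 b 0 s \<and> nats s ''b'' 0 = b)
    (For ''e'' (NAdd (scalar ''m'') (scalar ''m'')) make_leaf) (150 * N ^ 1)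
    (\<lambda>s. layer_inv 0 (Suc b) 0 s \<and> nats s ''b'' 0 = b)"
  proof (rule runs_weaken[OF runs_For[where k = "2 * m" and a = 50 and d = 0 and N = N
        and I = "\<lambda>e s. layer_inv 0 b e s \<and> nats s ''b'' 0 = b"]])
    fix e assume e: "e < 2 * m"
    show "runs (\<lambda>s. (layer_inv 0 b e s \<and> nats s ''b'' 0 = b) \<and> nats s ''e'' 0 = e) make_leaf
      (50 * N ^ 0) (\<lambda>s. (layer_inv 0 b (Suc e) s \<and> nats s ''b'' 0 = b) \<and> nats s ''e'' 0 = e)"
    proof (rule runs_loop_free)
      fix s assume s: "(layer_inv 0 b e s \<and> nats s ''b'' 0 = b) \<and> nats s ''e'' 0 = e"
      let ?s = "rwrite ''best'' (addr 0 b e) (mean e) (nwrite ''box'' (addr 0 b e) (Suc b) s)"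
      have mean: "reals s ''mean'' e = mean e" and node: "nats s ''node'' 0 = addr 0 b e"
        using s e by (simp_all add: layer_inv_def tables_def)
      have "nodes_correct (addr 0 b e) ?s"
        by (rule nodes_correct_cong[of _ s]) (use s in \<open>auto simp: layer_inv_def\<close>)
      then have "layer_inv 0 b e ?s"
        using s by (simp add: layer_inv_def tables_def)
      moreover have "node_correct ?s 0 b e"
        by (simp add: node_correct_def)
      ultimately have "layer_inv 0 b (Suc e) (nwrite ''node'' 0 (Suc (nats ?s ''node'' 0)) ?s)"
        using b e by (rule layer_inv_next)
      moreover have "run make_leaf s = nwrite ''node'' 0 (Suc (nats ?s ''node'' 0)) ?s"
        using s mean node by (simp add: make_leaf_def)
      ultimately show "(layer_inv 0 b (Suc e) (run make_leaf s) \<and>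
          nats (run make_leaf s) ''b'' 0 = b) \<and> nats (run make_leaf s) ''e'' 0 = e"
        using s by simp
    qed (simp_all add: make_leaf_def)
  next
    fix s assume "layer_inv 0 b (2 * m) s \<and> nats s ''b'' 0 = b"
    then show "layer_inv 0 (Suc b) 0 s \<and> nats s ''b'' 0 = b"
      by (simp add: layer_inv_def addr_end_row)
  qed (use layer_inv_params in \<open>auto simp: bounds\<close>)
qed (use layer_inv_params in \<open>auto simp: bounds power2_eq_square\<close>)

section \<open>Input, prefix sums and outcome tables\<close>

definition input_inv :: "state \<Rightarrow> bool" where
  "input_inv s \<longleftrightarrow> nats s ''n'' 0 = n \<and> nats s ''m'' 0 = m \<and> nats s ''node'' 0 = 0 \<and>
     (\<forall>j<m. reals s ''value'' j = v j \<and> reals s ''prob'' j = pmf F (v j))"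

definition prefix_inv :: "nat \<Rightarrow> state \<Rightarrow> bool" where
  "prefix_inv k s \<longleftrightarrow> (\<forall>j\<le>k. reals s ''cum_prob'' j = (\<Sum>l<j. pmf F (v l)) \<and>
     reals s ''cum_mean'' j = (\<Sum>l<j. pmf F (v l) * v l))"

definition outcome_inv :: "nat \<Rightarrow> state \<Rightarrow> bool" where
  "outcome_inv k s \<longleftrightarrow> (\<forall>j<k. \<forall>y. reals s ''mass'' (outcome y j) = mass (outcome y j) \<and>
     reals s ''mean'' (outcome y j) = mean (outcome y j))"

lemma runs_prefix_sums:
  "runs (\<lambda>s. input_inv s \<and> prefix_inv 0 s) (For ''j'' (scalar ''m'') prefix_sums)
    (250 * N ^ 1) (\<lambda>s. input_inv s \<and> prefix_inv m s)"
proof (rule runs_weaken[OF runs_For[where k = m and a = 100 and d = 0 and N = N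
      and I = "\<lambda>j s. input_inv s \<and> prefix_inv j s"]])
  fix j assume j: "j < m"
  show "runs (\<lambda>s. (input_inv s \<and> prefix_inv j s) \<and> nats s ''j'' 0 = j) prefix_sums (100 * N ^ 0)
    (\<lambda>s. (input_inv s \<and> prefix_inv (Suc j) s) \<and> nats s ''j'' 0 = j)"
    using j by (intro runs_loop_free)
      (auto simp: prefix_sums_def input_inv_def prefix_inv_def le_Suc_eq)
qed (auto simp: bounds input_inv_def prefix_inv_def)

lemma mass_outcome: "j < m \<Longrightarrow> mass (outcome y j) = hit F (v j) y"
  by (cases y) (auto simp: outcome_def mass_def)

lemma runs_outcome_tables:
  "runs (\<lambda>s. input_inv s \<and> prefix_inv m s) (For ''j'' (scalar ''m'') outcome_tables)
    (250 * N ^ 1) (layer_inv 0 0 0)"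
proof (rule runs_weaken[OF runs_For[where k = m and a = 100 and d = 0 and N = N
      and I = "\<lambda>j s. (input_inv s \<and> prefix_inv m s) \<and> outcome_inv j s"]])
  fix j assume j: "j < m"
  show "runs (\<lambda>s. ((input_inv s \<and> prefix_inv m s) \<and> outcome_inv j s) \<and> nats s ''j'' 0 = j)
    outcome_tables (100 * N ^ 0)
    (\<lambda>s. ((input_inv s \<and> prefix_inv m s) \<and> outcome_inv (Suc j) s) \<and> nats s ''j'' 0 = j)"
  proof (rule runs_loop_free)
    fix s assume s: "((input_inv s \<and> prefix_inv m s) \<and> outcome_inv j s) \<and> nats s ''j'' 0 = j"
    let ?s = "run outcome_tables s"
    have m: "nats s ''m'' 0 = m" using s by (simp add: input_inv_def)
    have cum: "reals s ''cum_prob'' i = (\<Sum>l<i. pmf F (v l))"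
      "reals s ''cum_mean'' i = (\<Sum>l<i. pmf F (v l) * v l)" if "i \<le> m" for i
      using s that by (simp_all add: prefix_inv_def)
    have run: "nats ?s = nats s" "reals ?s ''value'' = reals s ''value''" "reals ?s ''prob'' = reals s ''prob''"
      "reals ?s ''cum_prob'' = reals s ''cum_prob''" "reals ?s ''cum_mean'' = reals s ''cum_mean''"
      "reals ?s ''mass'' = (reals s ''mass'')(j := hit F (v j) True, m + j := hit F (v j) False)"
      "reals ?s ''mean'' =
        (reals s ''mean'')(j := cond_mean F (v j) True, m + j := cond_mean F (v j) False)"
      using s j m by (simp_all add: outcome_tables_def cum hit_eq_prefix_sum
          partial_mean_eq_prefix_sum cond_mean_def)
    have "input_inv ?s" using s run by (simp add: input_inv_def)
    moreover have "prefix_inv m ?s" using s run by (simp add: prefix_inv_def)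
    moreover have "outcome_inv (Suc j) ?s"
      unfolding outcome_inv_def
    proof (intro allI impI)
      fix i y assume "i < Suc j"
      then consider "i = j" | "i < j" by linarith
      then show "reals ?s ''mass'' (outcome y i) = mass (outcome y i) \<and>
          reals ?s ''mean'' (outcome y i) = mean (outcome y i)"
      proof cases
        case 1
        then show ?thesis using j
          by (simp add: run mass_outcome mean_outcome) (simp add: outcome_def)
      next
        case 2
        then have "outcome y i \<noteq> j" "outcome y i \<noteq> m + j" using j by (auto simp: outcome_def)
        then show ?thesis using s 2 by (simp add: run outcome_inv_def)
      qed
    qed
    ultimately show "((input_inv ?s \<and> prefix_inv m ?s) \<and> outcome_inv (Suc j) ?s) \<and>
        nats ?s ''j'' 0 = j"
      using s run by simp
  qed (simp_all add: outcome_tables_def)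
next
  fix s assume s: "(input_inv s \<and> prefix_inv m s) \<and> outcome_inv m s"
  have "reals s ''mass'' e = mass e \<and> reals s ''mean'' e = mean e" if "e < 2 * m" for e
  proof -
    \<comment> \<open>Every index below \<open>2 * m\<close> is an outcome: a yes below
      \<open>m\<close>, a no from \<open>m\<close> on.\<close>
    have "e = outcome (e < m) (if e < m then e else e - m)" by (simp add: outcome_def)
    moreover have "(if e < m then e else e - m) < m" using that by auto
    ultimately show ?thesis using s by (metis outcome_inv_def)
  qed
  then show "layer_inv 0 0 0 s"
    using s by (simp add: layer_inv_def tables_def input_inv_def nodes_correct_def addr_def)
qed (auto simp: bounds input_inv_def prefix_inv_def outcome_inv_def)

lemma length_value_prob_pairs: "length (value_prob_pairs F) = m"
  using finite_support by (simp add: value_prob_pairs_def m_def)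

lemma runs_dp_program:
  "runs (\<lambda>s. s = input n (value_prob_pairs F)) dp_program (6000 * N ^ 4) automaton_correct"
proof -
  \<comment> \<open>Cells without input are 0, as are the empty prefix sums and the first free
    address.\<close>
  have start: "input_inv s \<and> prefix_inv 0 s" if "s = input n (value_prob_pairs F)" for s
  proof -
    have "value_prob_pairs F ! j = (v j, pmf F (v j))" if "j < m" for j
      using that finite_support by (simp add: value_prob_pairs_def v_def m_def)
    then show ?thesis
      by (simp add: that input_inv_def prefix_inv_def input_def length_value_prob_pairs)
  qed
  have first: "runs (layer_inv 0 n 0) (Seq (set_scalar ''layer'' (scalar ''node''))
      (set_scalar ''fresh'' (NSub (scalar ''layer'') (NAdd (scalar ''m'') (scalar ''m'')))))
      20 (layer_inv (Suc 0) 0 0)"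
    (is "runs _ ?c _ _")
  proof (rule runs_loop_free)
    fix s assume s: "layer_inv 0 n 0 s"
    \<comment> \<open>The first layer above the leaves tests the last box, of index
      \<open>n - 1\<close>.\<close>
    have "n * (2 * m) - (m + m) = addr 0 (n - 1) 0"
      by (simp add: addr_def diff_mult_distrib)
    moreover have "nodes_correct q (run ?c s) = nodes_correct q s" for q
      by (auto intro: nodes_correct_cong)
    moreover have "addr 0 n 0 = n * (2 * m)" by (simp add: addr_def)
    ultimately show "layer_inv (Suc 0) 0 0 (run ?c s)"
      using s by (simp add: layer_inv_def tables_def addr_end_layer[symmetric])
  qed simp_all
  have layers: "runs (layer_inv (Suc 0) 0 0) (For ''k'' (scalar ''n'') make_layer) (4000 * N ^ 4)
      (layer_inv (Suc n) 0 0)"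
    by (rule runs_weaken[OF runs_For[where k = n and a = 1900 and d = 3 and N = N
      and I = "\<lambda>k. layer_inv (Suc k) 0 0", OF runs_make_layer]])
     (use layer_inv_params in \<open>auto simp: bounds\<close>)
  have last: "runs (layer_inv (Suc n) 0 0)
      (set_scalar ''start'' (NAdd (NSub (scalar ''node'') (scalar ''layer'')) (scalar ''m'')))
      20 automaton_correct"
    (is "runs _ ?c _ _")
  proof (rule runs_loop_free)
    fix s assume s: "layer_inv (Suc n) 0 0 s"
    have "nodes_correct q (run ?c s) = nodes_correct q s" for q
      by (auto intro: nodes_correct_cong)
    moreover have "addr (Suc n) 0 0 - n * (2 * m) + m = addr n 0 m"
      by (simp add: addr_Suc) (simp add: addr_def)
    ultimately show "automaton_correct (run ?c s)"
      using s by (simp add: automaton_correct_def layer_inv_def tables_def)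
  qed simp_all
  \<comment> \<open>The exponent 4 comes from the nested loops over \<open>k\<close>,
    \<open>b\<close>, \<open>e\<close> and \<open>j\<close>. Lower powers are raised to it, and the
    constants then add up to 4940.\<close>
  have "1 \<le> N ^ 4" "N ^ 1 \<le> N ^ 4" "N ^ 2 \<le> N ^ 4"
    using bounds(1) power_increasing[of 1 4 N] power_increasing[of 2 4 N] by auto
  then show ?thesis
    unfolding dp_program_def
    by (intro runs_weaken[OF runs_Seq[OF runs_prefix_sums runs_Seq[OF runs_outcome_tables
          runs_Seq[OF runs_make_leaves runs_Seq[OF first runs_Seq[OF layers last]]]]]])
       (use start in auto)
qed

end

theorem theorem5:
  "\<exists>(prog::com) (c::nat) (d::nat). \<forall>(n::nat) (F::real pmf).
     n \<ge> 1 \<longrightarrow> finite (set_pmf F) \<longrightarrow> set_pmf F \<subseteq> {0..} \<longrightarrow>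
     (\<exists>t s. exec prog (input n (value_prob_pairs F)) t s \<and>
        t \<le> c * (n + card (set_pmf F)) ^ d \<and>
        optimal n F (output_algorithm s))"
proof (rule exI[of _ dp_program], rule exI[of _ 6000], rule exI[of _ 4], intro allI impI)
  fix n :: nat and F :: "real pmf"
  assume "n \<ge> 1" "finite (set_pmf F)" "set_pmf F \<subseteq> {0..}"
  then interpret threshold_testing F n
    by unfold_locales
  show "\<exists>t s. exec dp_program (input n (value_prob_pairs F)) t s \<and>
      t \<le> 6000 * (n + card (set_pmf F)) ^ 4 \<and> optimal n F (output_algorithm s)"
    using runs_dp_program optimal_output unfolding runs_def N_def m_def by blast
qed

end
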